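(* Let $\vec{G}=(V,A)$ be an oriented graph. If $\vec{G}$ is $2$-freezable, then $|A|\ge 2|V|$.
   Context: An oriented graph is a digraph with no pair of opposite arcs $uv,vu$. A $k$-dicolouring is a map $V\to\{1,\dots,k\}$ with no monochromatic directed cycle; ${\cal D}_k(\vec{G})$ is the graph on the $k$-dicolourings, two adjacent if they differ on exactly one vertex. $\vec{G}$ is $k$-freezable if ${\cal D}_k(\vec{G})$ has an isolated vertex (a $k$-dicolouring in which no single vertex can be recoloured to obtain another $k$-dicolouring). *)

theory Defs
  imports "Graph_Theory.Graph_Theory" "HOL-Library.FuncSet"
begin

locale oriented_graph = digraph +
  assumes no_opposite_arcs: "(u, v) \<in> arcs_ends G \<Longrightarrow> (v, u) \<notin> arcs_ends G"

context pre_digraph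
begin

definition monochromatic :: "('a \<Rightarrow> nat) \<Rightarrow> 'b awalk \<Rightarrow> bool" where
  "monochromatic c p \<longleftrightarrow> (\<exists>i. \<forall>e \<in> set p. c (tail G e) = i \<and> c (head G e) = i)"

text \<open>Colourings are extensional functions, so that they correspond exactly to the maps
  from \<open>verts G\<close> to \<open>{1..k}\<close>.\<close>

definition dicolouring :: "nat \<Rightarrow> ('a \<Rightarrow> nat) \<Rightarrow> bool" where
  "dicolouring k c \<longleftrightarrow>
     c \<in> verts G \<rightarrow>\<^sub>E {1..k} \<and> \<not> (\<exists>p. cycle p \<and> monochromatic c p)"

text \<open>The undirected graph on the dicolourings, as a symmetric digraph.\<close>

definition dicolouring_graph :: "nat \<Rightarrow> ('a \<Rightarrow> nat) pair_pre_digraph" where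
  "dicolouring_graph k =
     \<lparr> pverts = {c. dicolouring k c},
       parcs = {(c, d). dicolouring k c \<and> dicolouring k d \<and>
                        (\<exists>!v. v \<in> verts G \<and> c v \<noteq> d v)} \<rparr>"

definition isolated_vertex :: "'a \<Rightarrow> bool" where
  "isolated_vertex v \<longleftrightarrow> v \<in> verts G \<and> (\<forall>w. (v, w) \<notin> arcs_ends G \<and> (w, v) \<notin> arcs_ends G)"

end

definition (in pre_digraph) freezable :: "nat \<Rightarrow> bool" where
  "freezable k \<longleftrightarrow> (\<exists>c. pre_digraph.isolated_vertex (with_proj (dicolouring_graph k)) c)"

lemma (in fin_digraph) pair_graph_dicolouring_graph: "pair_graph (dicolouring_graph k)"
proof -
  have fin: "finite {c. dicolouring k c}"
    by (rule finite_subset[of _ "verts G \<rightarrow>\<^sub>E {1..k}"])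
       (auto simp: dicolouring_def intro: finite_PiE)
  have sub: "parcs (dicolouring_graph k) \<subseteq> {c. dicolouring k c} \<times> {c. dicolouring k c}"
    by (auto simp: dicolouring_graph_def)
  have swap: "(\<exists>!v. v \<in> verts G \<and> c v \<noteq> d v) \<longleftrightarrow> (\<exists>!v. v \<in> verts G \<and> d v \<noteq> c v)" for c d :: "'a \<Rightarrow> nat"
    by (simp only: eq_commute)
  have "finite (parcs (dicolouring_graph k))"
    using finite_subset[OF sub] fin by blast
  moreover have "pverts (dicolouring_graph k) = {c. dicolouring k c}"
    by (simp add: dicolouring_graph_def)
  moreover have "sym (parcs (dicolouring_graph k))"
    using swap by (auto simp: dicolouring_graph_def sym_def)
  moreover have "fst e \<noteq> snd e" if "e \<in> parcs (dicolouring_graph k)" for e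
    using that by (auto simp: dicolouring_graph_def)
  ultimately show ?thesis
    using fin sub by unfold_locales (auto simp: symmetric_def)
qed

text \<open>An isolated vertex is a dicolouring in which no single vertex can be recoloured.\<close>

lemma (in pre_digraph) freezable_iff:
  "freezable k \<longleftrightarrow>
     (\<exists>c. dicolouring k c \<and>
          (\<forall>v \<in> verts G. \<forall>i. i \<noteq> c v \<longrightarrow> \<not> dicolouring k (c(v := i))))"
proof -
  have upd: "(\<exists>!v. v \<in> verts G \<and> c v \<noteq> d v) \<longleftrightarrow> (\<exists>v \<in> verts G. \<exists>i. i \<noteq> c v \<and> d = c(v := i))"
    if "dicolouring k c" "dicolouring k d" for c d
  proof
    have ext: "c \<in> extensional (verts G)" "d \<in> extensional (verts G)"
      using that by (simp_all add: dicolouring_def PiE_def)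
    assume "\<exists>!v. v \<in> verts G \<and> c v \<noteq> d v"
    then obtain v where v: "v \<in> verts G" "c v \<noteq> d v"
      and uniq: "\<And>w. w \<in> verts G \<Longrightarrow> c w \<noteq> d w \<Longrightarrow> w = v"
      by (elim ex1E) blast
    have "c w = d w" if "w \<notin> verts G" for w
      using ext that by (simp add: extensional_def)
    with uniq have "d = c(v := d v)"
      by (intro HOL.ext) (metis fun_upd_apply)
    with v show "\<exists>v \<in> verts G. \<exists>i. i \<noteq> c v \<and> d = c(v := i)"
      by (intro bexI[of _ v] exI[of _ "d v"]) auto
  next
    assume "\<exists>v \<in> verts G. \<exists>i. i \<noteq> c v \<and> d = c(v := i)"
    then obtain v i where v: "v \<in> verts G" "i \<noteq> c v" "d = c(v := i)" by blast
    show "\<exists>!v. v \<in> verts G \<and> c v \<noteq> d v"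
      by (rule ex1I[of _ v]) (use v in \<open>auto split: if_splits\<close>)
  qed
  have adj: "(c, d) \<in> parcs (dicolouring_graph k) \<longleftrightarrow> dicolouring k c \<and> dicolouring k d \<and>
      (\<exists>v \<in> verts G. \<exists>i. i \<noteq> c v \<and> d = c(v := i))" for c d
    using upd[of c d] by (auto simp: dicolouring_graph_def)
  have "(\<exists>!v. v \<in> verts G \<and> d v \<noteq> c v) \<longleftrightarrow> (\<exists>!v. v \<in> verts G \<and> c v \<noteq> d v)" for c d :: "'a \<Rightarrow> nat"
    by (simp only: eq_commute)
  then have adj_sym: "(d, c) \<in> parcs (dicolouring_graph k) \<longleftrightarrow> (c, d) \<in> parcs (dicolouring_graph k)"
    for c d
    unfolding dicolouring_graph_def by auto
  have pverts: "c \<in> pverts (dicolouring_graph k) \<longleftrightarrow> dicolouring k c" for c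
    by (simp add: dicolouring_graph_def)
  have iso: "pre_digraph.isolated_vertex (with_proj (dicolouring_graph k)) c \<longleftrightarrow>
      dicolouring k c \<and> (\<forall>d. (c, d) \<notin> parcs (dicolouring_graph k))" for c
    unfolding pre_digraph.isolated_vertex_def with_proj_simps pverts
    using adj_sym by blast
  have "(\<forall>d. (c, d) \<notin> parcs (dicolouring_graph k)) \<longleftrightarrow>
      (\<forall>v \<in> verts G. \<forall>i. i \<noteq> c v \<longrightarrow> \<not> dicolouring k (c(v := i)))"
    if "dicolouring k c" for c
    unfolding adj using that by blast
  then show ?thesis
    unfolding freezable_def iso by blast
qed

end

theory Submission
  imports Defs
begin

text \<open>Fix a frozen colouring. Recolouring \<open>v\<close> closes a directed cycle through \<open>v\<close> all of whose
  other vertices have the colour opposite to that of \<open>v\<close>. It enters and leaves \<open>v\<close> by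
  bichromatic arcs \<open>i v\<close> and \<open>o v\<close>, and since it has length at least 3, the arc \<open>m v\<close> preceding
  \<open>i v\<close> on it is monochromatic. The \<open>o v\<close> and the \<open>i v\<close> account for \<open>2 * card (verts G)\<close> arcs,
  except that some arcs may be both \<open>o x\<close> and \<open>i v\<close>; such an arc is determined by its tail \<open>x\<close>,
  so it is compensated by the monochromatic arc \<open>m v\<close>, whose head is \<open>x\<close>.\<close>

lemma (in wf_digraph) insert_heads_eq_insert_tails:
  "awalk u p w \<Longrightarrow> insert u (head G ` set p) = insert w (tail G ` set p)"
  by (induction p arbitrary: u) (auto simp: awalk_simps)

text \<open>On a closed walk each arc is followed, cyclically, by one whose tail is its head. As an
  equation of sets, this gives an arc entering and an arc leaving any vertex met, without rotating
  the walk.\<close>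

lemma (in wf_digraph) closed_awalk_heads_eq_tails:
  assumes "awalk u p u" "p \<noteq> []"
  shows "head G ` set p = tail G ` set p"
proof -
  have "u \<in> tail G ` set p"
    using assms by (cases p) (auto simp: awalk_simps)
  moreover have "u \<in> head G ` set p"
    using assms by (cases p rule: rev_cases) (auto simp: awalk_simps)
  ultimately show ?thesis
    using insert_heads_eq_insert_tails[OF assms(1)] by (metis insert_absorb)
qed

text \<open>The witnesses \<open>e1\<close>, \<open>e2\<close>, \<open>e3\<close> are the arcs
  called \<open>o v\<close>, \<open>i v\<close>, \<open>m v\<close> above, all taken from one
  cycle.\<close>

lemma (in oriented_graph) frozen_vertex_arcs:
  assumes c: "dicolouring 2 c"
    and frozen: "\<And>j. j \<noteq> c v \<Longrightarrow> \<not> dicolouring 2 (c(v := j))"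
    and v: "v \<in> verts G"
  shows "\<exists>e1 e2 e3. e1 \<in> arcs G \<and> tail G e1 = v \<and> c (head G e1) \<noteq> c v \<and>
    e2 \<in> arcs G \<and> head G e2 = v \<and> c (tail G e2) \<noteq> c v \<and>
    e3 \<in> arcs G \<and> head G e3 = tail G e2 \<and> c (tail G e3) = c (head G e3)"
proof -
  have range: "c \<in> verts G \<rightarrow>\<^sub>E {1..2}"
    and acyclic: "\<And>p. cycle p \<Longrightarrow> \<not> monochromatic c p"
    using c by (auto simp: dicolouring_def)
  \<comment> \<open>The map x to 3 - x swaps the two colours 1 and 2.\<close>
  define j where "j = 3 - c v"
  have "c v \<in> {1..2}" using range v by auto
  then have "1 \<le> c v" "c v \<le> 2" by auto
  then have j: "j \<noteq> c v" "j \<in> {1..2}" unfolding j_def atLeastAtMost_iff by presburger+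
  have "c(v := j) \<in> verts G \<rightarrow>\<^sub>E {1..2}"
    using range j(2) v by (auto simp: PiE_def extensional_def)
  with frozen[OF j(1)] obtain p where "cycle p" and mono: "monochromatic (c(v := j)) p"
    by (auto simp: dicolouring_def)
  then obtain u where p: "awalk u p u" "p \<noteq> []"
    by (auto simp: cycle_def)
  have heads: "head G ` set p = tail G ` set p"
    using closed_awalk_heads_eq_tails[OF p] .
  obtain i where i: "\<And>e. e \<in> set p \<Longrightarrow> (c(v := j)) (tail G e) = i \<and> (c(v := j)) (head G e) = i"
    using mono by (auto simp: monochromatic_def)
  have arcs: "set p \<subseteq> arcs G" using p(1) by (simp add: awalk_def)
  \<comment> \<open>A cycle avoiding \<open>v\<close> does not see the recolouring, so it would
    already be monochromatic under \<open>c\<close>.\<close>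
  have v_tail: "v \<in> tail G ` set p"
  proof (rule ccontr)
    assume "v \<notin> tail G ` set p"
    then have "tail G e \<noteq> v \<and> head G e \<noteq> v" if "e \<in> set p" for e
      using heads that by auto
    then have "monochromatic c p"
      using i unfolding monochromatic_def by (metis fun_upd_other)
    with acyclic[OF \<open>cycle p\<close>] show False by simp
  qed
  then obtain e1 where e1: "e1 \<in> set p" "tail G e1 = v" by auto
  have "v \<in> head G ` set p" using v_tail heads by simp
  then obtain e2 where e2: "e2 \<in> set p" "head G e2 = v" by auto
  have "tail G e2 \<in> head G ` set p" using heads e2(1) by auto
  then obtain e3 where e3: "e3 \<in> set p" "head G e3 = tail G e2" by auto
  \<comment> \<open>The cycle passes through \<open>v\<close>, so its common colour is the new
    colour of \<open>v\<close>; its other vertices had that colour before.\<close>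
  have "i = j" using i[OF e1(1)] e1(2) by simp
  then have other: "(tail G e \<noteq> v \<longrightarrow> c (tail G e) = j) \<and> (head G e \<noteq> v \<longrightarrow> c (head G e) = j)"
    if "e \<in> set p" for e
    using i[OF that] by (metis fun_upd_other)
  have in_arcs: "e1 \<in> arcs G" "e2 \<in> arcs G" "e3 \<in> arcs G" using arcs e1 e2 e3 by auto
  have neq: "head G e1 \<noteq> v" "tail G e2 \<noteq> v"
    using no_loops[OF in_arcs(1)] no_loops[OF in_arcs(2)] e1(2) e2(2) by auto
  \<comment> \<open>Otherwise \<open>e3\<close> and \<open>e2\<close> would be opposite arcs. Hence
    neither end of \<open>e3\<close> is \<open>v\<close>, and both have colour \<open>j\<close>
    under \<open>c\<close>.\<close>
  have "tail G e3 \<noteq> v"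
  proof
    assume "tail G e3 = v"
    then have "(v, tail G e2) \<in> arcs_ends G" "(tail G e2, v) \<in> arcs_ends G"
      using in_arcs e2(2) e3(2) by (force simp: arcs_ends_def arc_to_ends_def)+
    then show False using no_opposite_arcs by blast
  qed
  then show ?thesis
    using neq in_arcs e1(2) e2(2) e3(2) other[OF e1(1)] other[OF e2(1)] other[OF e3(1)] j(1)
    by metis
qed

theorem theorem14:
  fixes G :: "('a, 'b) pre_digraph"
  assumes "oriented_graph G"
    and "pre_digraph.freezable G 2"
  shows "card (arcs G) \<ge> 2 * card (verts G)"
proof -
  interpret oriented_graph G by fact
  obtain c where c: "dicolouring 2 c"
    "\<And>v j. v \<in> verts G \<Longrightarrow> j \<noteq> c v \<Longrightarrow> \<not> dicolouring 2 (c(v := j))"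
    using assms(2) unfolding freezable_iff by blast
  obtain out inn m where
    out: "\<And>v. v \<in> verts G \<Longrightarrow> out v \<in> arcs G \<and> tail G (out v) = v \<and> c (head G (out v)) \<noteq> c v"
    and inn: "\<And>v. v \<in> verts G \<Longrightarrow> inn v \<in> arcs G \<and> head G (inn v) = v \<and> c (tail G (inn v)) \<noteq> c v"
    and m: "\<And>v. v \<in> verts G \<Longrightarrow>
      m v \<in> arcs G \<and> head G (m v) = tail G (inn v) \<and> c (tail G (m v)) = c (head G (m v))"
    using frozen_vertex_arcs[OF c] by metis
  let ?V = "verts G"
  let ?O = "out ` ?V" and ?I = "inn ` ?V" and ?M = "m ` ?V"
  have card_O: "card ?O = card ?V"
    by (intro card_image inj_onI) (metis out)
  have card_I: "card ?I = card ?V"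
    by (intro card_image inj_onI) (metis inn)
  have tail_overlap: "inj_on (tail G) (?O \<inter> ?I)"
    by (rule inj_on_subset[of _ ?O]) (auto intro!: inj_onI simp: out)
  \<comment> \<open>Since \<open>m\<close> need not be injective, \<open>?M\<close> is bounded below
    by counting its heads, among which are all tails of arcs in \<open>?I\<close>.\<close>
  have "tail G (inn v) \<in> head G ` ?M" if "v \<in> ?V" for v
    using m[OF that] that by force
  then have "tail G ` (?O \<inter> ?I) \<subseteq> head G ` ?M"
    by (intro image_subsetI) (elim IntD2[THEN imageE], simp)
  then have "card (tail G ` (?O \<inter> ?I)) \<le> card (head G ` ?M)"
    by (intro card_mono) auto
  also have "\<dots> \<le> card ?M" by (intro card_image_le) auto
  finally have overlap: "card (?O \<inter> ?I) \<le> card ?M"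
    by (simp add: card_image[OF tail_overlap])
  \<comment> \<open>Bichromatic arcs on one side, monochromatic arcs on the other.\<close>
  have disjoint: "(?O \<union> ?I) \<inter> ?M = {}"
  proof -
    have "c (tail G e) \<noteq> c (head G e)" if "e \<in> ?O \<union> ?I" for e
      using that
    proof
      assume "e \<in> ?O"
      then obtain v where "v \<in> ?V" "e = out v" by blast
      with out[of v] show ?thesis by simp
    next
      assume "e \<in> ?I"
      then obtain v where "v \<in> ?V" "e = inn v" by blast
      with inn[of v] show ?thesis by simp
    qed
    moreover have "c (tail G e) = c (head G e)" if "e \<in> ?M" for e
    proof -
      from that obtain v where "v \<in> ?V" "e = m v" by blast
      with m[of v] show ?thesis by simp
    qed
    ultimately show ?thesis by blast
  qed
  have "2 * card ?V = card (?O \<union> ?I) + card (?O \<inter> ?I)"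
    using card_Un_Int[of ?O ?I] card_O card_I by simp
  also have "\<dots> \<le> card (?O \<union> ?I) + card ?M" using overlap by simp
  also have "\<dots> = card ((?O \<union> ?I) \<union> ?M)"
    by (intro card_Un_disjoint[symmetric]) (use disjoint in auto)
  also have "\<dots> \<le> card (arcs G)"
    by (intro card_mono) (use out inn m in auto)
  finally show ?thesis .
qed

end
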